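(* Let $d, N$ be integers with $2 \leq d < N$, and let $0 < c_1 < c_2$ be real numbers. For a vector system $v_1, \ldots, v_N \in \mathbb{R}^d$ of nonzero vectors define $$M(v_1, \ldots, v_N) = \min_{1 \leq k \leq N} \frac{|v_k|^2}{\sum_{l \neq k} \langle v_k, v_l \rangle^2}.$$ Then a vector system $(v_i)_{i=1}^N \subset \mathbb{R}^d$ satisfying $c_1 \leq |v_i|^2 \leq c_2$ for every $i \in \{1,\ldots,N\}$ is a maximizer of $M$ among all vector systems $(v_i)_{i=1}^N \subset \mathbb{R}^d$ subject to the condition $c_1 \leq |v_i|^2 \leq c_2$ for every $i \in \{1,\ldots,N\}$ if and only if $(v_i)_{i=1}^N$ is a uniform tight frame of norm $\sqrt{c_1}$.
   Context: $|\cdot|$ and $\langle \cdot,\cdot\rangle$ are the Euclidean norm and inner product on $\mathbb{R}^d$. Sums $\sum_{l \neq k}$ run over $l \in \{1,\ldots,N\}\setminus\{k\}$. Convention: a positive number divided by $0$ equals $+\infty$, so individual quotients may take the value $+\infty$. Vector systems are indexed families (repetitions are allowed). For $u,v \in \mathbb{R}^d$, $u \otimes v$ is the linear map $z \mapsto u\langle z, v\rangle$. A system $v_1,\ldots,v_N \in \mathbb{R}^d$ is a uniform tight frame of norm $c>0$ if $|v_k| = c$ for every $k$ and $\sum_{k=1}^N v_k \otimes v_k = \frac{N c^2}{d} I_d$, where $I_d$ is the identity on $\mathbb{R}^d$. *)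

theory Defs
  imports "HOL-Analysis.Analysis"
begin

text \<open>A system of \<open>N\<close> vectors is a function on \<^typ>\<open>nat\<close>, of which only the values on \<open>{1..N}\<close>
  are relevant.\<close>

definition tensor :: "real ^ 'd \<Rightarrow> real ^ 'd \<Rightarrow> real ^ 'd \<Rightarrow> real ^ 'd" where
  "tensor u v = (\<lambda>z. (z \<bullet> v) *\<^sub>R u)"

definition uniform_tight_frame :: "nat \<Rightarrow> real \<Rightarrow> (nat \<Rightarrow> real ^ 'd) \<Rightarrow> bool" where
  "uniform_tight_frame N c v \<longleftrightarrow>
     c > 0 \<and> (\<forall>k\<in>{1..N}. norm (v k) = c) \<and>
     (\<lambda>z. \<Sum>k=1..N. tensor (v k) (v k) z) = (\<lambda>z. (real N * c\<^sup>2 / real CARD('d)) *\<^sub>R z)"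

text \<open>The quotient is taken in \<^typ>\<open>ereal\<close>, where a positive number divided by \<open>0\<close> is \<open>\<infinity>\<close>.
  The definition is meant for \<open>N > 0\<close> and nonzero vectors.\<close>

definition M :: "nat \<Rightarrow> (nat \<Rightarrow> real ^ 'd) \<Rightarrow> ereal" where
  "M N v = Min ((\<lambda>k. ereal ((norm (v k))\<^sup>2) /
                     ereal (\<Sum>l\<in>{1..N} - {k}. (v k \<bullet> v l)\<^sup>2)) ` {1..N})"

definition norms_between :: "nat \<Rightarrow> real \<Rightarrow> real \<Rightarrow> (nat \<Rightarrow> real ^ 'd) \<Rightarrow> bool" where
  "norms_between N c1 c2 v \<longleftrightarrow> (\<forall>i\<in>{1..N}. c1 \<le> (norm (v i))\<^sup>2 \<and> (norm (v i))\<^sup>2 \<le> c2)"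

end

theory Submission imports Defs begin

text \<open>Write \<open>d\<close> for the dimension, \<open>a\<^sub>k = |v\<^sub>k|\<^sup>2\<close> and \<open>u\<^sub>k = v\<^sub>k / |v\<^sub>k|\<close>.
  The reciprocals of the quotients in \<^const>\<open>M\<close> are
  \<open>w\<^sub>k = \<Sum>\<^bsub>l \<noteq> k\<^esub> a\<^sub>l \<langle>u\<^sub>k, u\<^sub>l\<rangle>\<^sup>2\<close>. Since \<open>a\<^sub>l \<ge> c1\<close>, their sum is at least
  \<open>c1 (\<Sum>\<^bsub>k,l\<^esub> \<langle>u\<^sub>k, u\<^sub>l\<rangle>\<^sup>2 - N)\<close>, which is at least \<open>c1 (N\<^sup>2/d - N)\<close> by the frame potential
  inequality; so some \<open>w\<^sub>k\<close> is at least \<open>c1 (N - d)/d\<close>. If no \<open>w\<^sub>k\<close> exceeds this number, then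
  equality in the frame potential inequality makes \<open>u\<close> a tight frame, whence every \<open>u\<^sub>l\<close> is
  non-orthogonal to some other \<open>u\<^sub>k\<close> (as \<open>N > d\<close>), and this forces \<open>a\<^sub>l = c1\<close>. The bound is attained
  because uniform tight frames exist for all \<open>N > d\<close>: take \<open>d\<close> rows of a Hartley matrix, with
  frequencies symmetric about \<open>0\<close>.\<close>

section \<open>Frame operators and the frame potential\<close>

text \<open>Reduces the operator identity to entries of its matrix; it serves both the explicit
  construction and the equality case.\<close>

lemma tight_frame_of_entries:
  fixes v :: "nat \<Rightarrow> real ^ 'd"
  assumes "\<And>i j. (\<Sum>k=1..N. v k $ i * v k $ j) = (if i = j then A else 0)"
  shows "(\<lambda>z. \<Sum>k=1..N. tensor (v k) (v k) z) = (\<lambda>z. A *\<^sub>R z)"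
proof (intro ext, subst vec_eq_iff, intro allI)
  fix z :: "real ^ 'd" and i
  have "(\<Sum>k=1..N. tensor (v k) (v k) z) $ i = (\<Sum>k=1..N. \<Sum>j\<in>UNIV. z $ j * (v k $ i * v k $ j))"
    by (simp add: tensor_def inner_vec_def sum_distrib_left sum_distrib_right mult_ac)
  also have "\<dots> = (\<Sum>j\<in>UNIV. z $ j * (\<Sum>k=1..N. v k $ i * v k $ j))"
    by (subst sum.swap) (simp add: sum_distrib_left)
  also have "\<dots> = (\<Sum>j\<in>UNIV. if i = j then A * z $ j else 0)"
    by (intro sum.cong refl) (simp only: assms, simp)
  finally show "(\<Sum>k=1..N. tensor (v k) (v k) z) $ i = (A *\<^sub>R z) $ i" by simp
qed

lemma tight_frame_sum_inner_sq:
  fixes v :: "nat \<Rightarrow> real ^ 'd"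
  assumes "(\<lambda>z. \<Sum>k=1..N. tensor (v k) (v k) z) = (\<lambda>z. A *\<^sub>R z)"
  shows "(\<Sum>l=1..N. (x \<bullet> v l)\<^sup>2) = A * (norm x)\<^sup>2"
proof -
  have "(\<Sum>l=1..N. (x \<bullet> v l)\<^sup>2) = x \<bullet> (\<Sum>k=1..N. tensor (v k) (v k) x)"
    by (simp add: tensor_def inner_sum_right power2_eq_square)
  also have "\<dots> = x \<bullet> (A *\<^sub>R x)"
    using fun_cong[OF assms, of x] by simp
  finally show ?thesis by (simp add: power2_norm_eq_inner)
qed

text \<open>The left side is the squared Frobenius distance from the frame operator of
  \<open>u\<close> to \<open>A\<close> times the identity. Being an identity, it yields both the
  frame potential inequality and its equality case.\<close>

lemma frame_potential_excess:
  fixes u :: "nat \<Rightarrow> real ^ 'd"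
  assumes "\<And>k. k \<in> {1..N} \<Longrightarrow> norm (u k) = 1"
  defines "A \<equiv> real N / real CARD('d)"
  shows "(\<Sum>i\<in>UNIV. \<Sum>j\<in>UNIV. ((\<Sum>k=1..N. u k $ i * u k $ j) - (if i = j then A else 0))\<^sup>2)
    = (\<Sum>k=1..N. \<Sum>l=1..N. (u k \<bullet> u l)\<^sup>2) - (real N)\<^sup>2 / real CARD('d)"
proof -
  define G where "G i j = (\<Sum>k=1..N. u k $ i * u k $ j)" for i j
  have "(\<Sum>i\<in>UNIV. G i i) = (\<Sum>k=1..N. u k \<bullet> u k)"
    unfolding G_def by (subst sum.swap) (simp add: inner_vec_def)
  also have "\<dots> = (\<Sum>k=1..N. 1)"
    by (intro sum.cong refl) (metis assms(1) dot_square_norm one_power2)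
  finally have trace: "(\<Sum>i\<in>UNIV. G i i) = real N" by simp
  \<comment> \<open>The frame operator and the Gram matrix have the same Frobenius norm: moving
    \<open>k\<close>, \<open>l\<close> outside lets the sum over \<open>i\<close>, \<open>j\<close>
    factor into a squared inner product.\<close>
  have "(\<Sum>i\<in>UNIV. \<Sum>j\<in>UNIV. (G i j)\<^sup>2)
      = (\<Sum>i\<in>UNIV. \<Sum>j\<in>UNIV. \<Sum>k=1..N. \<Sum>l=1..N. (u k $ i * u l $ i) * (u k $ j * u l $ j))"
    by (simp add: G_def power2_eq_square sum_product mult_ac)
  also have "\<dots> = (\<Sum>i\<in>UNIV. \<Sum>k=1..N. \<Sum>j\<in>UNIV. \<Sum>l=1..N. (u k $ i * u l $ i) * (u k $ j * u l $ j))"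
    by (intro sum.cong refl sum.swap)
  also have "\<dots> = (\<Sum>k=1..N. \<Sum>i\<in>UNIV. \<Sum>j\<in>UNIV. \<Sum>l=1..N. (u k $ i * u l $ i) * (u k $ j * u l $ j))"
    by (rule sum.swap)
  also have "\<dots> = (\<Sum>k=1..N. \<Sum>i\<in>UNIV. \<Sum>l=1..N. \<Sum>j\<in>UNIV. (u k $ i * u l $ i) * (u k $ j * u l $ j))"
    by (intro sum.cong refl sum.swap)
  also have "\<dots> = (\<Sum>k=1..N. \<Sum>l=1..N. \<Sum>i\<in>UNIV. \<Sum>j\<in>UNIV. (u k $ i * u l $ i) * (u k $ j * u l $ j))"
    by (intro sum.cong refl sum.swap)
  also have "\<dots> = (\<Sum>k=1..N. \<Sum>l=1..N. (u k \<bullet> u l)\<^sup>2)"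
    by (simp add: inner_vec_def power2_eq_square sum_product)
  finally have potential: "(\<Sum>i\<in>UNIV. \<Sum>j\<in>UNIV. (G i j)\<^sup>2) = (\<Sum>k=1..N. \<Sum>l=1..N. (u k \<bullet> u l)\<^sup>2)" .
  have "(\<Sum>i\<in>UNIV. \<Sum>j\<in>UNIV. (G i j - (if i = j then A else 0))\<^sup>2)
      = (\<Sum>i\<in>UNIV. \<Sum>j\<in>UNIV. (G i j)\<^sup>2 + (if i = j then A\<^sup>2 - 2 * A * G i j else 0))"
    by (intro sum.cong refl) (simp add: power2_diff)
  also have "\<dots> = (\<Sum>i\<in>UNIV. \<Sum>j\<in>UNIV. (G i j)\<^sup>2) + (real CARD('d) * A\<^sup>2 - 2 * A * (\<Sum>i\<in>UNIV. G i i))"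
    by (simp add: sum.distrib sum_subtractf flip: sum_distrib_left)
  also have "real CARD('d) * A\<^sup>2 - 2 * A * (\<Sum>i\<in>UNIV. G i i) = - ((real N)\<^sup>2 / real CARD('d))"
    by (simp add: trace A_def power2_eq_square field_simps)
  finally show ?thesis
    using potential by (simp add: G_def)
qed

section \<open>Existence of uniform tight frames\<close>

text \<open>A geometric sum with ratio an \<open>N\<close>-th root of unity. Starting at 1 instead
  of 0 only costs a factor \<open>\<omega>\<close>.\<close>

lemma sum_roots_of_unity:
  fixes m :: int
  assumes "N > 0"
  defines "\<omega> \<equiv> cis (2 * pi * of_int m / real N)"
  shows "(\<Sum>k=1..N. cis (2 * pi * of_int m * real k / real N)) = (if \<omega> = 1 then of_nat N else 0)"
proof -
  have pow: "cis (2 * pi * of_int m * real k / real N) = \<omega> ^ k" for k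
    by (simp add: \<omega>_def Complex.DeMoivre field_simps)
  have "\<omega> ^ N = cis (2 * pi * of_int m)"
    unfolding pow[symmetric] using assms(1) by simp
  also have "\<dots> = 1" by (intro cis_multiple_2pi) simp
  finally have "\<omega> ^ N = 1" .
  moreover have "(\<Sum>k=1..N. \<omega> ^ k) = \<omega> * (\<Sum>k<N. \<omega> ^ k)"
    by (simp add: sum_distrib_left sum.atLeast1_atMost_eq)
  ultimately show ?thesis
    unfolding pow by (simp add: geometric_sum)
qed

text \<open>Both possible values of the sum of roots of unity are real.\<close>

lemma sum_sin_roots_of_unity:
  fixes m :: int
  assumes "N > 0"
  shows "(\<Sum>k=1..N. sin (2 * pi * of_int m * real k / real N)) = 0"
  using arg_cong[OF sum_roots_of_unity[OF assms, of m], of Im]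
  by (simp split: if_splits)

lemma sum_cos_roots_of_unity:
  fixes m :: int
  assumes "N > 0" "\<bar>m\<bar> < int N"
  shows "(\<Sum>k=1..N. cos (2 * pi * of_int m * real k / real N)) = (if m = 0 then real N else 0)"
proof (cases "m = 0")
  case False
  \<comment> \<open>Otherwise \<open>m\<close> would be a nonzero multiple of
    \<open>N\<close>.\<close>
  have "cis (2 * pi * of_int m / real N) \<noteq> 1"
  proof
    assume "cis (2 * pi * of_int m / real N) = 1"
    then have "cos (2 * pi * of_int m / real N) = 1"
      by (simp add: complex_eq_iff)
    then obtain n :: int where "2 * pi * of_int m / real N = of_int n * (2 * pi)"
      by (auto simp: cos_one_2pi_int)
    then have "real_of_int m = of_int (n * int N)"
      using assms(1) by (simp add: field_simps)
    then have "m = n * int N"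
      by (simp only: of_int_eq_iff)
    then show False
      using False assms(2) dvd_imp_le_int[of m "int N"] by auto
  qed
  then show ?thesis
    using False arg_cong[OF sum_roots_of_unity[OF assms(1), of m], of Re] by simp
qed simp

text \<open>The vectors are the columns of a scaled d by N matrix \<open>f\<close>: orthogonality of
  its rows gives tightness, and its columns have equal norm.\<close>

lemma uniform_tight_frame_exists:
  assumes "CARD('d) < N" "c > 0"
  shows "\<exists>v :: nat \<Rightarrow> real ^ 'd. uniform_tight_frame N c v"
proof -
  define d where "d = CARD('d)"
  have d: "d > 0" "d < N" using assms by (simp_all add: d_def)
  obtain h :: "'d \<Rightarrow> nat" where h: "bij_betw h UNIV {0..<d}"
    using ex_bij_betw_finite_nat[of "UNIV :: 'd set"] by (auto simp: d_def)
  \<comment> \<open>The frequencies are centred at 0, hence half-integers for even \<open>d\<close>;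
    only their sums and differences enter \<open>f_prod\<close>, and these are integers.\<close>
  define t where "t j k = 2 * pi * (real j - (real d - 1) / 2) * real k / real N" for j k :: nat
  define f where "f j k = cos (t j k) + sin (t j k)" for j k
  \<comment> \<open>Each column of \<open>f\<close> has squared norm \<open>d\<close>, so this
    scaling gives norm \<open>c\<close>.\<close>
  define s where "s = c / sqrt (real d)"
  have s2: "s\<^sup>2 = c\<^sup>2 / real d" by (simp add: s_def power_divide)
  define v :: "nat \<Rightarrow> real ^ 'd" where "v k = (\<chi> i. s * f (h i) k)" for k

  have f_prod: "f i k * f j k = cos (2 * pi * of_int (int i - int j) * real k / real N)
      + sin (2 * pi * of_int (int i + int j - (int d - 1)) * real k / real N)" for i j k
  proof -
    have "f i k * f j k = cos (t i k - t j k) + sin (t i k + t j k)"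
      by (simp add: f_def cos_diff sin_add algebra_simps)
    moreover have "t i k - t j k = 2 * pi * of_int (int i - int j) * real k / real N"
      by (simp add: t_def algebra_simps flip: diff_divide_distrib)
    moreover have "t i k + t j k = 2 * pi * of_int (int i + int j - (int d - 1)) * real k / real N"
      by (simp add: t_def algebra_simps flip: add_divide_distrib diff_divide_distrib)
        (simp add: field_simps)
    ultimately show ?thesis by simp
  qed
  have rows: "(\<Sum>k=1..N. f i k * f j k) = (if i = j then real N else 0)" if "i < d" "j < d" for i j
  proof -
    \<comment> \<open>The cosine sum then vanishes unless \<open>i = j\<close>; the sine sum
      vanishes at every integer frequency.\<close>
    have "\<bar>int i - int j\<bar> < int N" using that d by linarith
    moreover have "N > 0" using d by simp
    ultimately show ?thesis
      unfolding f_prod sum.distrib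
      by (simp only: sum_sin_roots_of_unity sum_cos_roots_of_unity) simp
  qed
  have columns: "(\<Sum>j=0..<d. (f j k)\<^sup>2) = real d" for k
  proof -
    \<comment> \<open>Reflecting \<open>j\<close> to \<open>d - 1 - j\<close> negates the frequency, so the sines cancel.\<close>
    have "(\<Sum>j=0..<d. sin (2 * t j k)) = (\<Sum>j=0..<d. sin (2 * t (d - Suc j) k))"
      using sum.nat_diff_reindex[of "\<lambda>j. sin (2 * t j k)" d] by (simp add: atLeast0LessThan)
    also have "\<dots> = (\<Sum>j=0..<d. - sin (2 * t j k))"
    proof (intro sum.cong refl)
      fix j assume "j \<in> {0..<d}"
      then have "t (d - Suc j) k = - t j k"
        using d by (simp add: t_def of_nat_diff field_simps)
      then show "sin (2 * t (d - Suc j) k) = - sin (2 * t j k)" by simp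
    qed
    finally have "(\<Sum>j=0..<d. sin (2 * t j k)) = 0" by (simp add: sum_negf)
    moreover have "(f j k)\<^sup>2 = 1 + sin (2 * t j k)" for j
      using sin_cos_squared_add[of "t j k"]
      by (simp add: f_def power2_sum sin_double algebra_simps)
    ultimately show ?thesis by (simp add: sum.distrib)
  qed

  have "norm (v k) = c" for k
  proof -
    have "(norm (v k))\<^sup>2 = s\<^sup>2 * (\<Sum>i\<in>UNIV. (f (h i) k)\<^sup>2)"
      unfolding power2_norm_eq_inner
      by (simp add: inner_vec_def v_def sum_distrib_left power2_eq_square mult_ac)
    also have "(\<Sum>i\<in>UNIV. (f (h i) k)\<^sup>2) = (\<Sum>j=0..<d. (f j k)\<^sup>2)"
      by (rule sum.reindex_bij_betw[OF h])
    finally have "(norm (v k))\<^sup>2 = c\<^sup>2" using d by (simp add: columns s2)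
    then show ?thesis using assms(2) by (simp add: power2_eq_iff_nonneg)
  qed
  moreover have "(\<Sum>k=1..N. v k $ i * v k $ j) = (if i = j then real N * c\<^sup>2 / real CARD('d) else 0)" for i j
  proof -
    have "h i < d" "h j < d" "h i = h j \<longleftrightarrow> i = j"
      using h by (auto simp: bij_betw_def inj_on_def)
    moreover have "(\<Sum>k=1..N. v k $ i * v k $ j) = s\<^sup>2 * (\<Sum>k=1..N. f (h i) k * f (h j) k)"
      by (simp add: v_def sum_distrib_left power2_eq_square mult_ac)
    ultimately show ?thesis using rows[of "h i" "h j"] by (simp add: s2 d_def)
  qed
  then have "(\<lambda>z. \<Sum>k=1..N. tensor (v k) (v k) z) = (\<lambda>z. (real N * c\<^sup>2 / real CARD('d)) *\<^sub>R z)"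
    by (rule tight_frame_of_entries)
  ultimately have "uniform_tight_frame N c v"
    using assms(2) by (simp add: uniform_tight_frame_def)
  then show ?thesis by (rule exI[of _ v])
qed

section \<open>The extremal value\<close>

text \<open>Clears denominators to pass from \<open>ereal\<close> to reals. An infinite quotient is
  harmless: for denominator 0 both sides of the equivalence hold.\<close>

lemma le_M_iff:
  assumes "N > 0" "B > 0" "\<And>k. k \<in> {1..N} \<Longrightarrow> v k \<noteq> 0"
  shows "ereal (1 / B) \<le> M N v \<longleftrightarrow>
    (\<forall>k\<in>{1..N}. (\<Sum>l\<in>{1..N} - {k}. (v k \<bullet> v l)\<^sup>2) \<le> B * (norm (v k))\<^sup>2)"
proof -
  have quotient: "ereal (1 / B) \<le> ereal a / ereal D \<longleftrightarrow> D \<le> B * a" if "a > 0" "D \<ge> 0" for a D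
  proof (cases "D = 0")
    case True
    then show ?thesis using that assms by simp
  next
    case False
    then show ?thesis using that assms by (simp add: field_simps)
  qed
  have Min_image: "x \<le> Min (f ` {1..N}) \<longleftrightarrow> (\<forall>k\<in>{1..N}. x \<le> f k)" for f :: "nat \<Rightarrow> ereal" and x
    using assms(1) by simp
  have "ereal (1 / B) \<le> M N v \<longleftrightarrow> (\<forall>k\<in>{1..N}. ereal (1 / B) \<le>
      ereal ((norm (v k))\<^sup>2) / ereal (\<Sum>l\<in>{1..N} - {k}. (v k \<bullet> v l)\<^sup>2))"
    unfolding M_def by (rule Min_image)
  also have "\<dots> \<longleftrightarrow> (\<forall>k\<in>{1..N}. (\<Sum>l\<in>{1..N} - {k}. (v k \<bullet> v l)\<^sup>2) \<le> B * (norm (v k))\<^sup>2)"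
    by (intro ball_cong refl quotient) (simp_all add: assms sum_nonneg)
  finally show ?thesis .
qed

text \<open>Tightness applied to \<open>v k\<close> itself, minus the diagonal term, makes all
  quotients equal.\<close>

lemma M_uniform_tight_frame:
  fixes v :: "nat \<Rightarrow> real ^ 'd"
  assumes "CARD('d) < N" "uniform_tight_frame N c v"
  shows "M N v = ereal (1 / (c\<^sup>2 * (real N / real CARD('d) - 1)))"
proof -
  let ?A = "real N / real CARD('d)"
  have c: "c > 0" and nrm: "\<And>k. k \<in> {1..N} \<Longrightarrow> norm (v k) = c"
    and tight: "(\<lambda>z. \<Sum>k=1..N. tensor (v k) (v k) z) = (\<lambda>z. (real N * c\<^sup>2 / real CARD('d)) *\<^sub>R z)"
    using assms(2) by (auto simp: uniform_tight_frame_def)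
  have "?A > 1" using assms(1) by simp
  have "ereal ((norm (v k))\<^sup>2) / ereal (\<Sum>l\<in>{1..N} - {k}. (v k \<bullet> v l)\<^sup>2)
      = ereal (1 / (c\<^sup>2 * (?A - 1)))" if k: "k \<in> {1..N}" for k
  proof -
    have "(\<Sum>l\<in>{1..N} - {k}. (v k \<bullet> v l)\<^sup>2) = (\<Sum>l=1..N. (v k \<bullet> v l)\<^sup>2) - (v k \<bullet> v k)\<^sup>2"
      using k by (simp add: sum_diff1)
    also have "\<dots> = c\<^sup>2 * (c\<^sup>2 * (?A - 1))"
      unfolding tight_frame_sum_inner_sq[OF tight] using k
      by (simp add: nrm power2_eq_square algebra_simps flip: power2_norm_eq_inner)
    finally have overlap: "(\<Sum>l\<in>{1..N} - {k}. (v k \<bullet> v l)\<^sup>2) = c\<^sup>2 * (c\<^sup>2 * (?A - 1))" .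
    have "c\<^sup>2 * (c\<^sup>2 * (?A - 1)) \<noteq> 0" using c \<open>?A > 1\<close> by simp
    then show ?thesis unfolding overlap nrm[OF k] using c
      by (simp only: ereal_divide) (simp add: divide_simps)
  qed
  then have "M N v = Min ((\<lambda>k. ereal (1 / (c\<^sup>2 * (?A - 1)))) ` {1..N})"
    unfolding M_def by (intro arg_cong[of _ _ Min] image_cong refl)
  then show ?thesis using assms(1) by (simp add: image_constant_conv)
qed

text \<open>Summing \<open>upper\<close>, normalised, over \<open>k\<close> leaves no slack, so the
  norm excess \<open>E\<close> and the frame potential excess both vanish.\<close>

lemma uniform_tight_frame_if_small_overlaps:
  fixes v :: "nat \<Rightarrow> real ^ 'd"
  assumes N: "CARD('d) < N" and c: "c > 0"
    and lower: "\<And>k. k \<in> {1..N} \<Longrightarrow> c \<le> (norm (v k))\<^sup>2"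
    and upper: "\<And>k. k \<in> {1..N} \<Longrightarrow> (\<Sum>l\<in>{1..N} - {k}. (v k \<bullet> v l)\<^sup>2)
        \<le> c * (real N / real CARD('d) - 1) * (norm (v k))\<^sup>2"
  shows "uniform_tight_frame N (sqrt c) v"
proof -
  define A where "A = real N / real CARD('d)"
  have A: "A > 1" using N by (simp add: A_def)
  define a where "a k = (norm (v k))\<^sup>2" for k
  define u where "u k = v k /\<^sub>R norm (v k)" for k
  define p where "p k l = (u k \<bullet> u l)\<^sup>2" for k l
  define P where "P = (\<Sum>k=1..N. \<Sum>l=1..N. p k l)"
  have nz: "v k \<noteq> 0" if "k \<in> {1..N}" for k
    using lower[OF that] c by auto
  have u1: "norm (u k) = 1" if "k \<in> {1..N}" for k
    using nz[OF that] by (simp add: u_def)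
  have vu: "v k = norm (v k) *\<^sub>R u k" if "k \<in> {1..N}" for k
    using nz[OF that] by (simp add: u_def)
  have pkk: "p k k = 1" if "k \<in> {1..N}" for k
    using u1[OF that] by (simp add: p_def flip: power2_norm_eq_inner)
  have excess: "(\<Sum>i\<in>UNIV. \<Sum>j\<in>UNIV. ((\<Sum>k=1..N. u k $ i * u k $ j) - (if i = j then A else 0))\<^sup>2)
      = P - real N * A"
    using frame_potential_excess[of N u, OF u1]
    unfolding P_def p_def A_def by (simp only: power2_eq_square times_divide_eq_right)

  \<comment> \<open>Dividing by \<open>a k\<close> leaves only the norms of the other
    vectors.\<close>
  have w: "(\<Sum>l\<in>{1..N} - {k}. a l * p k l) \<le> c * (A - 1)" if k: "k \<in> {1..N}" for k
  proof -
    have "(v k \<bullet> v l)\<^sup>2 = a k * (a l * p k l)" if "l \<in> {1..N}" for l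
      by (subst vu[OF k], subst vu[OF that]) (simp add: a_def p_def power_mult_distrib)
    then have "(\<Sum>l\<in>{1..N} - {k}. (v k \<bullet> v l)\<^sup>2) = a k * (\<Sum>l\<in>{1..N} - {k}. a l * p k l)"
      by (simp add: sum_distrib_left)
    then have "a k * (\<Sum>l\<in>{1..N} - {k}. a l * p k l) \<le> a k * (c * (A - 1))"
      using upper[OF k] by (simp add: a_def A_def mult_ac)
    moreover have "a k > 0" using nz[OF k] by (simp add: a_def)
    ultimately show ?thesis by (simp only: mult_le_cancel_left_pos)
  qed
  have P_off: "(\<Sum>k=1..N. \<Sum>l\<in>{1..N} - {k}. p k l) = P - real N"
  proof -
    have "(\<Sum>k=1..N. \<Sum>l\<in>{1..N} - {k}. p k l) = (\<Sum>k=1..N. (\<Sum>l=1..N. p k l) - 1)"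
      by (intro sum.cong refl) (simp add: sum_diff1 pkk)
    then show ?thesis by (simp add: P_def sum_subtractf)
  qed
  define E where "E = (\<Sum>k=1..N. \<Sum>l\<in>{1..N} - {k}. (a l - c) * p k l)"
  have "E = (\<Sum>k=1..N. \<Sum>l\<in>{1..N} - {k}. a l * p k l) - c * (P - real N)"
    unfolding E_def P_off[symmetric] by (simp add: left_diff_distrib sum_subtractf sum_distrib_left)
  moreover have "(\<Sum>k=1..N. \<Sum>l\<in>{1..N} - {k}. a l * p k l) \<le> (\<Sum>k=1..N. c * (A - 1))"
    by (intro sum_mono w)
  ultimately have E_le: "E \<le> - (c * (P - real N * A))"
    by (simp add: algebra_simps)
  have term_nonneg: "(a l - c) * p k l \<ge> 0" if "l \<in> {1..N}" for k l
    using lower[OF that] by (simp add: a_def p_def)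
  then have E_nonneg: "E \<ge> 0"
    unfolding E_def by (intro sum_nonneg) auto
  have "P - real N * A \<ge> 0"
    unfolding excess[symmetric] by (intro sum_nonneg) auto
  then have "c * (P - real N * A) \<ge> 0" using c by simp
  \<comment> \<open>\<open>E_le\<close> bounds the sum of these two nonnegative quantities by
    0.\<close>
  then have "E = 0" and "c * (P - real N * A) = 0" using E_le E_nonneg by linarith+
  then have "P - real N * A = 0" using c by simp
  then have G: "(\<Sum>k=1..N. u k $ i * u k $ j) = (if i = j then A else 0)" for i j
    using excess by (simp add: sum_nonneg_eq_0_iff sum_nonneg)
  have terms: "(a l - c) * p k l = 0" if "k \<in> {1..N}" "l \<in> {1..N} - {k}" for k l
  proof -
    have "(\<Sum>l\<in>{1..N} - {k}. (a l - c) * p k l) = 0"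
      using \<open>E = 0\<close> that(1) unfolding E_def
      by (subst (asm) sum_nonneg_eq_0_iff) (auto intro!: sum_nonneg term_nonneg)
    then show ?thesis
      using that(2) by (subst (asm) sum_nonneg_eq_0_iff) (auto intro!: term_nonneg)
  qed
  \<comment> \<open>Otherwise \<open>u l\<close> is orthogonal to all other \<open>u k\<close>, so
    its squared inner products sum to 1, whereas tightness makes this sum
    \<open>A > 1\<close>.\<close>
  have ac: "a l = c" if l: "l \<in> {1..N}" for l
  proof (rule ccontr)
    assume "a l \<noteq> c"
    then have "p l k = 0" if "k \<in> {1..N} - {l}" for k
      using terms[of k l] that l by (auto simp: p_def inner_commute)
    then have "(\<Sum>k=1..N. p l k) = 1"
      using sum.remove[OF _ l, of "p l"] pkk[OF l] by simp
    moreover have "(\<Sum>k=1..N. p l k) = A"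
      using tight_frame_sum_inner_sq[OF tight_frame_of_entries[OF G], of "u l"] u1[OF l]
      by (simp add: p_def)
    ultimately show False using A by simp
  qed
  have norm_v: "norm (v k) = sqrt c" if "k \<in> {1..N}" for k
    using ac[OF that] by (auto simp: a_def real_sqrt_unique[symmetric])
  have "(\<Sum>k=1..N. v k $ i * v k $ j) = (if i = j then real N * (sqrt c)\<^sup>2 / real CARD('d) else 0)" for i j
  proof -
    have "(\<Sum>k=1..N. v k $ i * v k $ j) = (\<Sum>k=1..N. c * (u k $ i * u k $ j))"
    proof (intro sum.cong refl)
      fix k assume k: "k \<in> {1..N}"
      have "v k = sqrt c *\<^sub>R u k" using vu[OF k] norm_v[OF k] by simp
      then show "v k $ i * v k $ j = c * (u k $ i * u k $ j)" using c by simp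
    qed
    then show ?thesis using G[of i j] c by (simp add: A_def flip: sum_distrib_left)
  qed
  from tight_frame_of_entries[OF this] show ?thesis
    using c norm_v by (simp add: uniform_tight_frame_def)
qed

theorem theorem1:
  fixes N :: nat and c1 c2 :: real and v :: "nat \<Rightarrow> real ^ 'd"
  assumes "2 \<le> CARD('d)" and "CARD('d) < N"
    and "0 < c1" and "c1 < c2"
    and "norms_between N c1 c2 v"
  shows "is_arg_max (M N) (norms_between N c1 c2) v \<longleftrightarrow> uniform_tight_frame N (sqrt c1) v"
proof -
  \<comment> \<open>The reciprocal of the value of \<open>M\<close> at a uniform tight frame of norm
    \<open>sqrt c1\<close>.\<close>
  define B where "B = c1 * (real N / real CARD('d) - 1)"
  have B: "B > 0" using assms by (simp add: B_def)
  have M_frame: "M N x = ereal (1 / B)" if "uniform_tight_frame N (sqrt c1) x" for x :: "nat \<Rightarrow> real ^ 'd"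
    using M_uniform_tight_frame[OF assms(2) that] assms(3) by (simp add: B_def)
  have frame: "uniform_tight_frame N (sqrt c1) x"
    if x: "norms_between N c1 c2 x" and le: "ereal (1 / B) \<le> M N x" for x :: "nat \<Rightarrow> real ^ 'd"
  proof -
    have lower: "c1 \<le> (norm (x k))\<^sup>2" if "k \<in> {1..N}" for k
      using x that by (simp add: norms_between_def)
    then have "x k \<noteq> 0" if "k \<in> {1..N}" for k
      using that assms(3) by fastforce
    then have "\<forall>k\<in>{1..N}. (\<Sum>l\<in>{1..N} - {k}. (x k \<bullet> x l)\<^sup>2) \<le> B * (norm (x k))\<^sup>2"
      using le B assms(2) by (subst (asm) le_M_iff) auto
    then show ?thesis
      using lower assms(2,3) unfolding B_def
      by (intro uniform_tight_frame_if_small_overlaps) auto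
  qed
  show ?thesis
  proof
    assume max: "is_arg_max (M N) (norms_between N c1 c2) v"
    \<comment> \<open>An admissible competitor of value \<open>1 / B\<close>, forcing a maximizer to
      reach at least that value.\<close>
    obtain x :: "nat \<Rightarrow> real ^ 'd" where x: "uniform_tight_frame N (sqrt c1) x"
      using uniform_tight_frame_exists[OF assms(2), of "sqrt c1"] assms(3) by auto
    then have "norms_between N c1 c2 x"
      using assms by (simp add: uniform_tight_frame_def norms_between_def)
    then have "M N x \<le> M N v" using max by (auto simp: is_arg_max_def not_less)
    then show "uniform_tight_frame N (sqrt c1) v"
      using frame[OF assms(5)] M_frame[OF x] by simp
  next
    assume "uniform_tight_frame N (sqrt c1) v"
    then show "is_arg_max (M N) (norms_between N c1 c2) v"
      using assms(5) unfolding is_arg_max_def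
      \<comment> \<open>A strictly better admissible system would by \<open>frame\<close> be a
        uniform tight frame, hence have the same value.\<close>
      by (auto dest!: frame[OF _ less_imp_le] simp: M_frame)
  qed
qed

end
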